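(* Let $G$ be an $n$-vertex graph with minimum degree $\delta(G)\ge 1$. Then $a_u(G)\le \frac{n-1}{\delta(G)}$, with equality if and only if $G$ is the complete graph $K_n$ or the cycle $C_5$ (up to isomorphism).
   Context: Graphs are finite, simple and undirected. The vertices of a graph carry nonnegative integer weights. A unit acquisition move transfers one unit of weight from a vertex $u$ of positive weight to a neighbor $v$ of $u$, under the condition that before the move the weight of $v$ is at least the weight of $u$. The unit acquisition number $a_u(G)$ is the minimum size to which the set of vertices with positive weight can be reduced via successive unit acquisition moves, starting from the configuration in which every vertex has weight $1$. $\delta(G)$ denotes the minimum vertex degree of $G$. *)

theory Defs
  imports Complex_Main "Graph_Theory.Graph_Theory"
begin

text \<open>
  Finite simple undirected graphs are the locale \<^locale>\<open>graph\<close> of Graph_Theory: finite symmetric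
  digraphs without loops and parallel arcs. An undirected edge is a pair of opposite arcs, so the
  degree of a vertex is its out-degree. The locale admits the graph without vertices, for which
  \<open>min_degree\<close> below is unspecified.
\<close>

definition min_degree :: "('a, 'b) pre_digraph \<Rightarrow> nat" where
  "min_degree G = Min (out_degree G ` verts G)"

text \<open>This is the simple cycle on \<open>n\<close> vertices only for \<open>n \<ge> 3\<close>.\<close>

definition cycle_graph :: "nat \<Rightarrow> nat pair_pre_digraph" where
  "cycle_graph n =
     \<lparr>pverts = {..<n},
      parcs = {(i, j). i < n \<and> j < n \<and> (j = Suc i mod n \<or> i = Suc j mod n)}\<rparr>"

definition unit_acquisition_move ::
  "('a, 'b) pre_digraph \<Rightarrow> ('a \<Rightarrow> nat) \<Rightarrow> ('a \<Rightarrow> nat) \<Rightarrow> bool" where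
  "unit_acquisition_move G w w' \<longleftrightarrow>
     (\<exists>u v. u \<rightarrow>\<^bsub>G\<^esub> v \<and> 0 < w u \<and> w u \<le> w v \<and> w' = w(u := w u - 1, v := w v + 1))"

text \<open>
  Weights are total functions on the vertex type; values off \<open>verts G\<close> are never moved or counted.
\<close>

definition unit_acquisition_number :: "('a, 'b) pre_digraph \<Rightarrow> nat" where
  "unit_acquisition_number G =
     (LEAST k. \<exists>w. (unit_acquisition_move G)\<^sup>*\<^sup>* (\<lambda>_. 1) w \<and> card {v \<in> verts G. 0 < w v} = k)"

end

theory Submission
  imports Defs
begin

text \<open>
A vertex \<open>v\<close> of weight at least \<open>2\<close> can absorb the whole branch at a neighbour \<open>u\<close> of weight \<open>1\<close>, namely
\<open>u\<close> together with any neighbours of \<open>u\<close> of weight \<open>1\<close>: a child of \<open>u\<close> moves its unit to \<open>u\<close>, which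
passes a unit on to \<open>v\<close>, and so on for each child, so that \<open>u\<close> never weighs more than \<open>2\<close>
(\<open>absorb_branch\<close>). A root of weight \<open>1\<close> first has to reach weight \<open>2\<close>, and does so by taking the unit
of a neighbour \<open>u\<close>, whose children are then stranded. Hence a tree of depth two collapses to
its root and the children of one branch of our choice.

For the bound, take a maximal set of vertices with pairwise disjoint closed neighbourhoods. Every other
vertex is within distance two of it, so the vertices are partitioned into trees of depth two rooted in
this set, each containing all neighbours of its root. In a tree whose smallest branch has size \<open>s\<close>,
only \<open>s\<close> vertices keep positive weight, and at least \<open>\<delta> * s\<close> vertices lie outside the root. Summing
up, \<open>\<delta> * a + r \<le> n\<close>, where \<open>a\<close> is the acquisition number and \<open>r\<close> the number of roots
(\<open>packing_bound\<close>).

Equality therefore forces \<open>r = 1\<close> for every choice of the set, so any vertex can be the root, and all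
branches then have the same size \<open>a\<close> (\<open>tight_balanced\<close>). So the graph is \<open>\<delta>\<close>-regular, and since a leaf
cannot be moved to another branch, two distinct nonadjacent vertices have exactly one common neighbour
(\<open>tight_common_neighbour_unique\<close>). If \<open>a = 1\<close>, there are no leaves and the graph is complete. If
\<open>a = 2\<close>, each neighbourhood is complete except for a perfect matching, and by uniqueness of common
neighbours the degree is \<open>2\<close>, leaving only the five-cycle (\<open>tight_imp_five_cycle\<close>). If \<open>a \<ge> 3\<close>, one of
the stranded leaves can be brought to the root through another branch, so \<open>a\<close> was not minimal
(\<open>tight_unit_acquisition_le_2\<close>).

Conversely, the bound itself gives \<open>1\<close> for complete graphs and \<open>2\<close> for the five-cycle; that the five-cycle
cannot do with \<open>1\<close> follows from an invariant (\<open>divided\<close>).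
\<close>

(* The arrow of function sets would make the notation for adjacency ambiguous. *)
unbundle no funcset_syntax

context graph
begin

section \<open>Moves and degrees\<close>

abbreviation moves :: "('a \<Rightarrow> nat) \<Rightarrow> ('a \<Rightarrow> nat) \<Rightarrow> bool" where
  "moves \<equiv> (unit_acquisition_move G)\<^sup>*\<^sup>*"

abbreviation nbs :: "'a \<Rightarrow> 'a set" where
  "nbs v \<equiv> {u. u \<rightarrow> v}"

lemma adj_sym: "u \<rightarrow> v \<Longrightarrow> v \<rightarrow> u"
  by (rule arcs_ends_symmetric[OF sym_arcs])

lemma nbs_subset_verts: "nbs v \<subseteq> verts G"
  by (auto dest: adj_in_verts)

lemma finite_nbs: "finite (nbs v)"
  using nbs_subset_verts finite_verts by (rule finite_subset)

lemma out_degree_eq_card_nbs: "out_degree G v = card (nbs v)"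
proof -
  have "inj_on (head G) (out_arcs G v)"
    by (rule inj_onI) (auto intro: no_multi_arcs simp: arc_to_ends_def)
  moreover have "head G ` out_arcs G v = {u. v \<rightarrow> u}"
    by (force simp: arcs_ends_conv)
  moreover have "{u. v \<rightarrow> u} = nbs v"
    by (auto intro: adj_sym)
  ultimately show ?thesis
    unfolding out_degree_def by (metis card_image)
qed

lemma moveI:
  assumes "u \<rightarrow> v" and "0 < w u" and "w u \<le> w v"
  shows "moves w (w(u := w u - 1, v := w v + 1))"
  using assms unfolding unit_acquisition_move_def by blast

lemma unit_acquisition_number_le:
  assumes "moves (\<lambda>_. 1) w"
  shows "unit_acquisition_number G \<le> card {v \<in> verts G. 0 < w v}"
  unfolding unit_acquisition_number_def using assms by (blast intro: Least_le)

lemma unit_acquisition_number_attained: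
  obtains w where "moves (\<lambda>_. 1) w" and "card {v \<in> verts G. 0 < w v} = unit_acquisition_number G"
proof -
  have "\<exists>w. moves (\<lambda>_. 1) w \<and> card {v \<in> verts G. 0 < w v} = unit_acquisition_number G"
    unfolding unit_acquisition_number_def
    by (rule LeastI_ex[of "\<lambda>k. \<exists>w. moves (\<lambda>_. 1) w \<and> card {v \<in> verts G. 0 < w v} = k"]) blast
  then show thesis using that by blast
qed

lemma unit_acquisition_number_pos:
  assumes "verts G \<noteq> {}"
  shows "1 \<le> unit_acquisition_number G"
proof -
  have pos: "\<exists>x\<in>verts G. 0 < w x" if "moves (\<lambda>_. 1) w" for w
    using that
  proof (induction rule: rtranclp_induct)
    case base
    then show ?case using assms by auto
  next
    case (step w w')
    then show ?case
      unfolding unit_acquisition_move_def by (auto dest: adj_in_verts)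
  qed
  obtain w where w: "moves (\<lambda>_. 1) w" "card {v \<in> verts G. 0 < w v} = unit_acquisition_number G"
    by (rule unit_acquisition_number_attained)
  have "{v \<in> verts G. 0 < w v} \<noteq> {}" using pos[OF w(1)] by blast
  then have "0 < card {v \<in> verts G. 0 < w v}" by (simp add: card_gt_0_iff)
  then show ?thesis using w(2) by simp
qed

lemma min_degree_le:
  assumes "v \<in> verts G"
  shows "min_degree G \<le> card (nbs v)"
  unfolding min_degree_def out_degree_eq_card_nbs[symmetric] using assms by (intro Min_le) auto

lemma min_degree_regular:
  assumes "verts G \<noteq> {}" and "\<forall>v\<in>verts G. card (nbs v) = d"
  shows "min_degree G = d"
proof -
  have "out_degree G ` verts G = {d}"
    using assms by (auto simp: out_degree_eq_card_nbs)
  then show ?thesis by (simp add: min_degree_def)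
qed

section \<open>Collapsing trees of depth two\<close>

text \<open>
The order of moves is what matters: collecting the whole branch at \<open>u\<close> first could make \<open>u\<close>
heavier than \<open>v\<close>. Passing each unit on at once keeps the weight of \<open>u\<close> at most \<open>2\<close>, which \<open>v\<close> can
always receive.
\<close>

lemma absorb_branch:
  assumes "finite C" and "u \<rightarrow> v" and "\<forall>c\<in>C. c \<rightarrow> u" and "v \<notin> C"
    and "w u = 1" and "\<forall>c\<in>C. w c = 1" and "2 \<le> w v"
  shows "\<exists>w'. moves w w' \<and> w' v = w v + 1 + card C \<and> (\<forall>x\<in>insert u C. w' x = 0)
    \<and> (\<forall>x. x \<notin> insert v (insert u C) \<longrightarrow> w' x = w x)"
  using assms
proof (induction C arbitrary: w rule: finite_induct)
  case empty
  then have "moves w (w(u := w u - 1, v := w v + 1))" and "u \<noteq> v"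
    using adj_not_same moveI[of u v w] by auto
  then show ?case
    using empty by (intro exI[of _ "w(u := w u - 1, v := w v + 1)"] conjI) (assumption | simp)+
next
  case (insert c C)
  then have ne: "u \<noteq> v" "c \<noteq> u" "c \<noteq> v" "u \<notin> C"
    using adj_not_same[of u] by auto
  define w1 where "w1 = w(c := 0, u := 2)"
  define w2 where "w2 = w(c := 0, v := w v + 1)"
  have "moves w w1"
    using moveI[of c u w] insert.prems ne by (auto simp: w1_def numeral_2_eq_2)
  also have "moves w1 w2"
  proof -
    have "w2 = w1(u := w1 u - 1, v := w1 v + 1)"
      using insert.prems ne by (auto simp: w1_def w2_def)
    then show ?thesis
      using moveI[of u v w1] insert.prems ne by (auto simp: w1_def)
  qed
  finally have "moves w w2" .
  moreover have "\<exists>w'. moves w2 w' \<and> w' v = w2 v + 1 + card C \<and> (\<forall>x\<in>insert u C. w' x = 0)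
    \<and> (\<forall>x. x \<notin> insert v (insert u C) \<longrightarrow> w' x = w2 x)"
    using insert.prems insert.hyps ne by (intro insert.IH) (auto simp: w2_def)
  then obtain w' where "moves w2 w'" "w' v = w2 v + 1 + card C" "\<forall>x\<in>insert u C. w' x = 0"
    "\<forall>x. x \<notin> insert v (insert u C) \<longrightarrow> w' x = w2 x" by blast
  ultimately show ?case
    using insert.hyps ne by (intro exI[of _ w']) (auto simp: w2_def)
qed

text \<open>
The tree is given by its root \<open>v\<close>, the set \<open>B\<close> of neighbours of \<open>v\<close> in it, and the leaves, which
are the vertices of \<open>L\<close> that \<open>par\<close> sends into \<open>B\<close>. Letting \<open>L\<close> contain further vertices allows the
same \<open>L\<close> and \<open>par\<close> to serve for many disjoint trees.
\<close>

lemma absorb_branches: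
  assumes "finite B" and "finite L" and "\<forall>u\<in>B. u \<rightarrow> v" and "\<forall>x\<in>L. par x \<in> B \<longrightarrow> x \<rightarrow> par x"
    and "v \<notin> L" and "B \<inter> L = {}"
    and "\<forall>x\<in>B \<union> {x\<in>L. par x \<in> B}. w x = 1" and "2 \<le> w v"
  shows "\<exists>w'. moves w w' \<and> w v + card B \<le> w' v \<and> (\<forall>x\<in>B \<union> {x\<in>L. par x \<in> B}. w' x = 0)
    \<and> (\<forall>x. x \<notin> insert v (B \<union> {x\<in>L. par x \<in> B}) \<longrightarrow> w' x = w x)"
  using assms
proof (induction B arbitrary: w rule: finite_induct)
  case empty
  then show ?case by auto
next
  case (insert u B)
  have ne: "v \<notin> insert u B"
    using insert.prems adj_not_same by auto
  define C where "C = {x\<in>L. par x = u}"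
  have "\<exists>w1. moves w w1 \<and> w1 v = w v + 1 + card C \<and> (\<forall>x\<in>insert u C. w1 x = 0)
    \<and> (\<forall>x. x \<notin> insert v (insert u C) \<longrightarrow> w1 x = w x)"
    using insert.prems by (intro absorb_branch) (auto simp: C_def)
  then obtain w1 where w1: "moves w w1" "w1 v = w v + 1 + card C" "\<forall>x\<in>insert u C. w1 x = 0"
    "\<forall>x. x \<notin> insert v (insert u C) \<longrightarrow> w1 x = w x" by blast
  have "\<exists>w2. moves w1 w2 \<and> w1 v + card B \<le> w2 v \<and> (\<forall>x\<in>B \<union> {x\<in>L. par x \<in> B}. w2 x = 0)
    \<and> (\<forall>x. x \<notin> insert v (B \<union> {x\<in>L. par x \<in> B}) \<longrightarrow> w2 x = w1 x)"
  proof (rule insert.IH)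
    show "\<forall>x\<in>B \<union> {x \<in> L. par x \<in> B}. w1 x = 1"
    proof
      fix x assume x: "x \<in> B \<union> {x \<in> L. par x \<in> B}"
      then have "x \<notin> insert v (insert u C)"
        using insert.hyps insert.prems ne by (auto simp: C_def)
      then show "w1 x = 1"
        using w1(4) x insert.prems by auto
    qed
  qed (use insert.prems w1(2) in auto)
  then obtain w2 where w2: "moves w1 w2" "w1 v + card B \<le> w2 v"
    "\<forall>x\<in>B \<union> {x\<in>L. par x \<in> B}. w2 x = 0"
    "\<forall>x. x \<notin> insert v (B \<union> {x\<in>L. par x \<in> B}) \<longrightarrow> w2 x = w1 x" by blast
  have 1: "moves w w2" using w1(1) w2(1) by simp
  have 2: "w v + card (insert u B) \<le> w2 v"
    using w1(2) w2(2) insert.hyps by simp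
  have 3: "w2 x = 0" if x: "x \<in> insert u B \<union> {x\<in>L. par x \<in> insert u B}" for x
  proof (cases "x \<in> B \<union> {x\<in>L. par x \<in> B}")
    case False
    then have "x \<in> insert u C" "x \<noteq> v" using x insert.prems ne by (auto simp: C_def)
    then show ?thesis using False w1(3) w2(4) by auto
  qed (use w2(3) in auto)
  have 4: "w2 x = w x" if "x \<notin> insert v (insert u B \<union> {x\<in>L. par x \<in> insert u B})" for x
    using that w1(4) w2(4) by (auto simp: C_def)
  show ?case using 1 2 3 4 by blast
qed

abbreviation closed_nbs :: "'a \<Rightarrow> 'a set" where
  "closed_nbs v \<equiv> insert v (nbs v)"

definition packing :: "'a set \<Rightarrow> bool" where
  "packing S \<longleftrightarrow> S \<subseteq> verts G \<and> (\<forall>s\<in>S. \<forall>t\<in>S. s \<noteq> t \<longrightarrow> closed_nbs s \<inter> closed_nbs t = {})"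

text \<open>
For a maximal packing these are the vertices at distance exactly two from it; they will become the
leaves of the trees rooted in the packing.
\<close>

definition uncovered :: "'a set \<Rightarrow> 'a set" where
  "uncovered S = verts G - (\<Union>s\<in>S. closed_nbs s)"

definition parent_map :: "'a set \<Rightarrow> ('a \<Rightarrow> 'a) \<Rightarrow> bool" where
  "parent_map S par \<longleftrightarrow> (\<forall>x\<in>uncovered S. x \<rightarrow> par x \<and> par x \<in> (\<Union>s\<in>S. nbs s))"

lemma finite_uncovered: "finite (uncovered S)"
  by (simp add: uncovered_def)

lemma packing_finite: "packing S \<Longrightarrow> finite S"
  using finite_subset[OF _ finite_verts] by (auto simp: packing_def)

lemma packing_nbs_disjoint: "packing S \<Longrightarrow> s \<in> S \<Longrightarrow> t \<in> S \<Longrightarrow> x \<rightarrow> s \<Longrightarrow> x \<rightarrow> t \<Longrightarrow> s = t"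
  unfolding packing_def by blast

lemma packing_independent: "packing S \<Longrightarrow> s \<in> S \<Longrightarrow> t \<in> S \<Longrightarrow> \<not> s \<rightarrow> t"
  unfolding packing_def using adj_not_same[of s] by (cases "s = t") blast+

text \<open>
At each root \<open>s\<close> the neighbour \<open>m s\<close> is sacrificed: its unit moves to \<open>s\<close> at the very start, which
brings \<open>s\<close> to weight \<open>2\<close> and strands the children of \<open>m s\<close>. All other branches at \<open>s\<close> are then
absorbed. Trees of different roots share no vertices, so the trees of the remaining roots are still in
their initial state, as the induction needs; the last conjunct records this.
\<close>

lemma collapse_trees:
  assumes pack: "packing S" and par: "parent_map S par" and m: "\<forall>s\<in>S. m s \<in> nbs s"
    and "finite F" and "F \<subseteq> S"
  shows "\<exists>w. moves (\<lambda>_. 1) w \<and> (\<forall>x\<in>\<Union>s\<in>F. nbs s. w x = 0)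
    \<and> (\<forall>x\<in>uncovered S. par x \<in> (\<Union>s\<in>F. nbs s) - m ` F \<longrightarrow> w x = 0)
    \<and> (\<forall>x. x \<notin> (\<Union>s\<in>F. closed_nbs s) \<and> (x \<in> uncovered S \<longrightarrow> par x \<notin> (\<Union>s\<in>F. nbs s)) \<longrightarrow> w x = 1)"
  using assms(4,5)
proof (induction F rule: finite_induct)
  case empty
  then show ?case by auto
next
  case (insert s F)
  then obtain w where w: "moves (\<lambda>_. 1) w" "\<forall>x\<in>\<Union>s\<in>F. nbs s. w x = 0"
    "\<forall>x\<in>uncovered S. par x \<in> (\<Union>s\<in>F. nbs s) - m ` F \<longrightarrow> w x = 0"
    "\<forall>x. x \<notin> (\<Union>s\<in>F. closed_nbs s) \<and> (x \<in> uncovered S \<longrightarrow> par x \<notin> (\<Union>s\<in>F. nbs s)) \<longrightarrow> w x = 1"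
    by auto
  have s: "s \<in> S" "F \<subseteq> S" "m s \<rightarrow> s"
    using insert.prems m by auto
  then have "m s \<noteq> s" using adj_not_same[of s] by metis
  have disj: "x \<notin> (\<Union>t\<in>F. closed_nbs t)" if "x \<in> closed_nbs s" for x
  proof -
    have "closed_nbs s \<inter> closed_nbs t = {}" if "t \<in> F" for t
    proof -
      have "t \<in> S" "s \<noteq> t" using that s insert.hyps by auto
      then show ?thesis using pack s(1) unfolding packing_def by simp
    qed
    then show ?thesis using that by blast
  qed
  have "s \<notin> uncovered S" "nbs s \<inter> uncovered S = {}"
    using s by (auto simp: uncovered_def)
  have fresh: "w x = 1" if "x \<in> closed_nbs s \<union> {x\<in>uncovered S. par x \<in> nbs s}" for x
  proof -
    have "x \<notin> (\<Union>s\<in>F. closed_nbs s) \<and> (x \<in> uncovered S \<longrightarrow> par x \<notin> (\<Union>s\<in>F. nbs s))"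
    proof (cases "x \<in> closed_nbs s")
      case True
      then have "x \<notin> uncovered S" using s by (auto simp: uncovered_def)
      then show ?thesis using disj[OF True] by blast
    next
      case False
      then have "x \<in> uncovered S" "par x \<in> nbs s" using that by auto
      then have "par x \<notin> (\<Union>s\<in>F. closed_nbs s)" "x \<notin> (\<Union>s\<in>F. closed_nbs s)"
        using disj[of "par x"] s by (auto simp: uncovered_def)
      then show ?thesis by blast
    qed
    then show ?thesis using w(4) by blast
  qed
  define w1 where "w1 = w(m s := 0, s := 2)"
  have "moves w w1"
    using moveI[of "m s" s w] s \<open>m s \<noteq> s\<close> fresh[of s] fresh[of "m s"] by (simp add: w1_def numeral_2_eq_2)
  define B where "B = nbs s - {m s}"
  have "\<exists>w'. moves w1 w' \<and> w1 s + card B \<le> w' s \<and> (\<forall>x\<in>B \<union> {x\<in>uncovered S. par x \<in> B}. w' x = 0)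
    \<and> (\<forall>x. x \<notin> insert s (B \<union> {x\<in>uncovered S. par x \<in> B}) \<longrightarrow> w' x = w1 x)"
  proof (rule absorb_branches)
    show "\<forall>x\<in>B \<union> {x \<in> uncovered S. par x \<in> B}. w1 x = 1"
    proof
      fix x assume x: "x \<in> B \<union> {x \<in> uncovered S. par x \<in> B}"
      then have "x \<noteq> s" "x \<noteq> m s"
        using s adj_not_same[of s] by (auto simp: B_def uncovered_def)
      moreover have "w x = 1" using x by (intro fresh) (auto simp: B_def)
      ultimately show "w1 x = 1" by (simp add: w1_def)
    qed
    show "B \<inter> uncovered S = {}" using \<open>nbs s \<inter> uncovered S = {}\<close> by (auto simp: B_def)
  qed (use par \<open>s \<notin> uncovered S\<close> finite_nbs in \<open>auto simp: B_def w1_def parent_map_def finite_uncovered\<close>)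
  then obtain w2 where w2: "moves w1 w2" "\<forall>x\<in>B \<union> {x\<in>uncovered S. par x \<in> B}. w2 x = 0"
    "\<forall>x. x \<notin> insert s (B \<union> {x\<in>uncovered S. par x \<in> B}) \<longrightarrow> w2 x = w1 x" by blast
  have 1: "moves (\<lambda>_. 1) w2"
    using w(1) \<open>moves w w1\<close> w2(1) by (meson rtranclp_trans)
  have 2: "w2 x = 0" if "x \<in> (\<Union>s\<in>insert s F. nbs s)" for x
  proof (cases "x \<in> nbs s")
    case True
    moreover have "m s \<notin> insert s (B \<union> {x\<in>uncovered S. par x \<in> B})"
      using s \<open>m s \<noteq> s\<close> \<open>nbs s \<inter> uncovered S = {}\<close> by (auto simp: B_def)
    ultimately show ?thesis using w2 s by (cases "x = m s") (auto simp: B_def w1_def)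
  next
    case False
    then have x: "x \<in> (\<Union>s\<in>F. nbs s)" using that by auto
    then have "x \<noteq> s" "x \<notin> uncovered S" "x \<noteq> m s" using disj[of s] s False by (auto simp: uncovered_def)
    then show ?thesis using w2(3) w(2) x False by (auto simp: B_def w1_def)
  qed
  have 3: "w2 x = 0" if x: "x \<in> uncovered S" and p: "par x \<in> (\<Union>s\<in>insert s F. nbs s) - m ` insert s F" for x
  proof (cases "par x \<in> nbs s")
    case True
    then show ?thesis using x p w2(2) by (auto simp: B_def)
  next
    case False
    then have "x \<noteq> s" "x \<noteq> m s" "par x \<notin> B"
      using x s \<open>nbs s \<inter> uncovered S = {}\<close> \<open>s \<notin> uncovered S\<close> by (auto simp: B_def)
    moreover have "x \<notin> B" using x \<open>nbs s \<inter> uncovered S = {}\<close> by (auto simp: B_def)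
    moreover have "w x = 0" using x p False w(3) by auto
    ultimately show ?thesis using w2(3) by (auto simp: w1_def)
  qed
  have 4: "w2 x = 1"
    if "x \<notin> (\<Union>s\<in>insert s F. closed_nbs s)" and "x \<in> uncovered S \<longrightarrow> par x \<notin> (\<Union>s\<in>insert s F. nbs s)" for x
  proof -
    have "x \<noteq> m s" "x \<notin> insert s (B \<union> {x\<in>uncovered S. par x \<in> B})"
      using that s by (auto simp: B_def)
    moreover have "w x = 1" using that w(4) by auto
    ultimately show ?thesis using w2(3) by (auto simp: w1_def)
  qed
  show ?case
    by (intro exI[of _ w2] conjI ballI allI impI)
      (rule 1 | erule 2 | erule (1) 3 | elim conjE, erule (1) 4)+
qed

section \<open>The upper bound\<close>

lemma unit_acquisition_number_le_stranded:
  assumes pack: "packing S" and par: "parent_map S par" and m: "\<forall>s\<in>S. m s \<in> nbs s"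
  shows "unit_acquisition_number G \<le> (\<Sum>s\<in>S. 1 + card {x\<in>uncovered S. par x = m s})"
proof -
  note fin = packing_finite[OF pack]
  from collapse_trees[OF pack par m fin order_refl]
  obtain w where w: "moves (\<lambda>_. 1) w" "\<forall>x\<in>\<Union>s\<in>S. nbs s. w x = 0"
    "\<forall>x\<in>uncovered S. par x \<in> (\<Union>s\<in>S. nbs s) - m ` S \<longrightarrow> w x = 0" by blast
  have sub: "{v \<in> verts G. 0 < w v} \<subseteq> S \<union> (\<Union>s\<in>S. {x\<in>uncovered S. par x = m s})"
  proof
    fix x assume x: "x \<in> {v \<in> verts G. 0 < w v}"
    show "x \<in> S \<union> (\<Union>s\<in>S. {x\<in>uncovered S. par x = m s})"
    proof (cases "x \<in> uncovered S")
      case True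
      then have "par x \<in> (\<Union>s\<in>S. nbs s)" using par by (simp add: parent_map_def)
      then show ?thesis using w(3) x True by auto
    next
      case False
      then show ?thesis using w(2) x by (auto simp: uncovered_def)
    qed
  qed
  have "unit_acquisition_number G \<le> card {v \<in> verts G. 0 < w v}"
    by (rule unit_acquisition_number_le[OF w(1)])
  also have "\<dots> \<le> card (S \<union> (\<Union>s\<in>S. {x\<in>uncovered S. par x = m s}))"
    using sub fin finite_uncovered by (intro card_mono) auto
  also have "\<dots> \<le> card S + card (\<Union>s\<in>S. {x\<in>uncovered S. par x = m s})"
    by (rule card_Un_le)
  also have "\<dots> \<le> card S + (\<Sum>s\<in>S. card {x\<in>uncovered S. par x = m s})"
    using card_UN_le[OF fin] by auto
  also have "\<dots> = (\<Sum>s\<in>S. 1 + card {x\<in>uncovered S. par x = m s})"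
    by (simp only: sum.distrib) simp
  finally show ?thesis .
qed

lemma card_verts_packing:
  assumes pack: "packing S" and par: "parent_map S par"
  shows "card (verts G) = card S + (\<Sum>s\<in>S. \<Sum>u\<in>nbs s. 1 + card {x\<in>uncovered S. par x = u})"
proof -
  note fin = packing_finite[OF pack]
  let ?N = "\<Union>s\<in>S. nbs s"
  have finN: "finite ?N" using fin finite_nbs by blast
  have disjN: "\<forall>i\<in>S. \<forall>j\<in>S. i \<noteq> j \<longrightarrow> nbs i \<inter> nbs j = {}"
    using packing_nbs_disjoint[OF pack] by (intro ballI impI) auto
  have "S \<inter> ?N = {}" using packing_independent[OF pack] by auto
  moreover have "(S \<union> ?N) \<inter> uncovered S = {}" by (auto simp: uncovered_def)
  moreover have "verts G = (S \<union> ?N) \<union> uncovered S"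
    using pack nbs_subset_verts by (auto simp: uncovered_def packing_def)
  ultimately have "card (verts G) = card S + card ?N + card (uncovered S)"
    using fin finN finite_uncovered by (simp add: card_Un_disjoint)
  moreover have "card (uncovered S) = (\<Sum>u\<in>?N. card {x\<in>uncovered S. par x = u})"
  proof -
    have "uncovered S = (\<Union>u\<in>?N. {x\<in>uncovered S. par x = u})"
      using par by (auto simp: parent_map_def)
    then have "card (uncovered S) = card (\<Union>u\<in>?N. {x\<in>uncovered S. par x = u})" by simp
    also have "\<dots> = (\<Sum>u\<in>?N. card {x\<in>uncovered S. par x = u})"
      using finN finite_uncovered by (intro card_UN_disjoint) auto
    finally show ?thesis .
  qed
  moreover have "card ?N + (\<Sum>u\<in>?N. card {x\<in>uncovered S. par x = u})
      = (\<Sum>u\<in>?N. 1 + card {x\<in>uncovered S. par x = u})"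
    by (simp only: sum.distrib) simp
  moreover have "\<dots> = (\<Sum>s\<in>S. \<Sum>u\<in>nbs s. 1 + card {x\<in>uncovered S. par x = u})"
    using fin finite_nbs disjN by (intro sum.UNION_disjoint) auto
  ultimately show ?thesis by simp
qed

lemma maximal_packing_parent_map:
  assumes pack: "packing S" and max: "\<And>x. x \<in> verts G \<Longrightarrow> packing (insert x S) \<Longrightarrow> x \<in> S"
  obtains par where "parent_map S par"
proof -
  have "\<exists>y. x \<rightarrow> y \<and> y \<in> (\<Union>s\<in>S. nbs s)" if x: "x \<in> uncovered S" for x
  proof -
    have "x \<in> verts G" "x \<notin> S" using x by (auto simp: uncovered_def)
    then have "\<not> packing (insert x S)" using max by blast
    then obtain s where "s \<in> S" "closed_nbs x \<inter> closed_nbs s \<noteq> {}"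
      using pack \<open>x \<in> verts G\<close> unfolding packing_def by blast
    then show ?thesis using x by (auto simp: uncovered_def dest: adj_sym)
  qed
  then obtain par where "\<forall>x\<in>uncovered S. x \<rightarrow> par x \<and> par x \<in> (\<Union>s\<in>S. nbs s)"
    by metis
  then show thesis using that by (simp add: parent_map_def)
qed

lemma packing_extends_to_maximal:
  assumes "packing S"
  obtains T where "packing T" "S \<subseteq> T" "\<And>x. x \<in> verts G \<Longrightarrow> packing (insert x T) \<Longrightarrow> x \<in> T"
proof -
  let ?P = "{T. packing T \<and> S \<subseteq> T}"
  have "finite ?P"
    by (rule finite_subset[of _ "Pow (verts G)"]) (auto simp: packing_def)
  moreover have "?P \<noteq> {}" using assms by blast
  ultimately obtain T where T: "T \<in> ?P" "\<forall>U\<in>?P. T \<le> U \<longrightarrow> T = U"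
    using finite_has_maximal by metis
  then show thesis by (intro that[of T]) blast+
qed

text \<open>
Sacrifice the branch with the fewest children \<open>c\<close> at each root. The tree then leaves at most
\<open>1 + c\<close> vertices of positive weight, while it has at least \<open>d\<close> branches of at least \<open>1 + c\<close> vertices
each, besides the root. Summing over the trees shows that every vertex of the packing improves the
bound by one, so a packing with two vertices rules out equality.
\<close>

lemma packing_bound:
  assumes pack: "packing S" and deg: "\<forall>v\<in>verts G. d \<le> card (nbs v)" and "1 \<le> d"
  shows "d * unit_acquisition_number G + card S \<le> card (verts G)"
proof -
  obtain T where T: "packing T" "S \<subseteq> T" "\<And>x. x \<in> verts G \<Longrightarrow> packing (insert x T) \<Longrightarrow> x \<in> T"
    using packing_extends_to_maximal[OF pack] by blast
  obtain par where par: "parent_map T par"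
    using maximal_packing_parent_map[OF T(1,3)] by blast
  let ?c = "\<lambda>u. card {x\<in>uncovered T. par x = u}"
  have degT: "d \<le> card (nbs s)" if "s \<in> T" for s
    using that T(1) deg by (auto simp: packing_def)
  have ne: "nbs s \<noteq> {}" if "s \<in> T" for s
    using degT[OF that] \<open>1 \<le> d\<close> by (metis card.empty not_one_le_zero le_trans)
  define m where "m s = arg_min_on ?c (nbs s)" for s
  have m: "\<forall>s\<in>T. m s \<in> nbs s"
    unfolding m_def using arg_min_if_finite(1)[OF finite_nbs ne] by blast
  have min: "?c (m s) \<le> ?c u" if "s \<in> T" "u \<in> nbs s" for s u
    unfolding m_def using arg_min_least[OF finite_nbs ne, of s u ?c] that by blast
  have "d * unit_acquisition_number G \<le> d * (\<Sum>s\<in>T. 1 + ?c (m s))"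
    using unit_acquisition_number_le_stranded[OF T(1) par m] by simp
  also have "\<dots> = (\<Sum>s\<in>T. d * (1 + ?c (m s)))" by (rule sum_distrib_left)
  also have "\<dots> \<le> (\<Sum>s\<in>T. \<Sum>u\<in>nbs s. 1 + ?c u)"
  proof (rule sum_mono)
    fix s assume s: "s \<in> T"
    have "d * (1 + ?c (m s)) \<le> card (nbs s) * (1 + ?c (m s))"
      using degT[OF s] by (rule mult_le_mono1)
    also have "\<dots> \<le> (\<Sum>u\<in>nbs s. 1 + ?c u)"
      using min[OF s] sum_bounded_below[of "nbs s" "1 + ?c (m s)" "\<lambda>u. 1 + ?c u"] by simp
    finally show "d * (1 + ?c (m s)) \<le> (\<Sum>u\<in>nbs s. 1 + ?c u)" .
  qed
  finally have "d * unit_acquisition_number G + card T \<le> card (verts G)"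
    using card_verts_packing[OF T(1) par] by simp
  moreover have "card S \<le> card T" using card_mono[OF packing_finite[OF T(1)] T(2)] .
  ultimately show ?thesis by simp
qed

section \<open>Regularity of the graphs attaining the bound\<close>

definition tight :: "nat \<Rightarrow> bool" where
  "tight d \<longleftrightarrow> 1 \<le> d \<and> (\<forall>v\<in>verts G. d \<le> card (nbs v))
    \<and> d * unit_acquisition_number G + 1 = card (verts G)"

lemma uncovered_singleton: "uncovered {v} = {x \<in> verts G. x \<noteq> v \<and> \<not> x \<rightarrow> v}"
  by (auto simp: uncovered_def)

lemma packing_singleton: "v \<in> verts G \<Longrightarrow> packing {v}"
  by (simp add: packing_def)

text \<open>
Otherwise \<open>v\<close> and \<open>x\<close> would form a packing of size two.
\<close>

lemma tight_parent_exists: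
  assumes "tight d" and "v \<in> verts G" and "x \<in> uncovered {v}"
  shows "\<exists>y. x \<rightarrow> y \<and> y \<rightarrow> v"
proof (rule ccontr)
  assume no: "\<not> ?thesis"
  have x: "x \<in> verts G" "x \<noteq> v" "\<not> x \<rightarrow> v" "\<not> v \<rightarrow> x"
    using assms(3) by (auto simp: uncovered_singleton dest: adj_sym)
  then have "closed_nbs v \<inter> closed_nbs x = {}"
    using no by (auto dest: adj_sym)
  then have "packing {v, x}"
    using assms(2) x(1) unfolding packing_def by auto
  then have "d * unit_acquisition_number G + card {v, x} \<le> card (verts G)"
    using assms(1) by (intro packing_bound) (auto simp: tight_def)
  then show False using assms(1) x(2) by (simp add: tight_def)
qed

lemma tight_parent_map:
  assumes "tight d" and "v \<in> verts G"
  obtains par where "parent_map {v} par"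
proof -
  have "\<forall>x\<in>uncovered {v}. \<exists>y. x \<rightarrow> y \<and> y \<rightarrow> v"
    using tight_parent_exists[OF assms] by blast
  then obtain par where "\<forall>x\<in>uncovered {v}. x \<rightarrow> par x \<and> par x \<rightarrow> v"
    by metis
  then show thesis using that by (simp add: parent_map_def)
qed

text \<open>
With a single tree, the number of vertices other than the root is the sum over its branches of their
sizes. Every branch could be the sacrificed one, so each has size at least the acquisition number
\<open>k\<close>; as there are at least \<open>d\<close> branches and only \<open>d * k\<close> such vertices, equality holds throughout.
\<close>

lemma tight_balanced:
  assumes t: "tight d" and v: "v \<in> verts G" and par: "parent_map {v} par"
  shows "card (nbs v) = d"
    and "u \<rightarrow> v \<Longrightarrow> 1 + card {x\<in>uncovered {v}. par x = u} = unit_acquisition_number G"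
proof -
  let ?k = "unit_acquisition_number G"
  let ?c = "\<lambda>u. card {x\<in>uncovered {v}. par x = u}"
  have d: "1 \<le> d" "d \<le> card (nbs v)" "d * ?k + 1 = card (verts G)"
    using t v by (auto simp: tight_def)
  have sum: "d * ?k = (\<Sum>u\<in>nbs v. 1 + ?c u)"
    using card_verts_packing[OF packing_singleton[OF v] par] d(3) by simp
  have le: "?k \<le> 1 + ?c u" if "u \<in> nbs v" for u
    using unit_acquisition_number_le_stranded[OF packing_singleton[OF v] par, of "\<lambda>_. u"] that by simp
  have sum_le: "card (nbs v) * ?k \<le> (\<Sum>u\<in>nbs v. 1 + ?c u)"
    using sum_bounded_below[of "nbs v" ?k "\<lambda>u. 1 + ?c u"] le by simp
  have "0 < ?k"
  proof (rule ccontr)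
    assume "\<not> 0 < ?k"
    then have "(\<Sum>u\<in>nbs v. 1 + ?c u) = 0" using sum by simp
    then have "nbs v = {}" by (simp add: finite_nbs)
    then show False using d by simp
  qed
  then show deg: "card (nbs v) = d"
    using sum sum_le d(2) by (metis le_antisym mult_le_cancel2)
  show "1 + ?c u = ?k" if "u \<rightarrow> v"
  proof (rule ccontr)
    assume "1 + ?c u \<noteq> ?k"
    then have "?k < 1 + ?c u" using le that by (simp add: le_neq_implies_less)
    then have "(\<Sum>u\<in>nbs v. ?k) < (\<Sum>u\<in>nbs v. 1 + ?c u)"
      using le that finite_nbs by (intro sum_strict_mono_ex1) auto
    then show False using sum deg by simp
  qed
qed

lemma tight_degree: "tight d \<Longrightarrow> v \<in> verts G \<Longrightarrow> card (nbs v) = d"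
  using tight_balanced(1) tight_parent_map by metis

lemma tight_nbs_nonempty: "tight d \<Longrightarrow> v \<in> verts G \<Longrightarrow> nbs v \<noteq> {}"
  using tight_degree[of d v] by (metis card.empty not_one_le_zero tight_def)

text \<open>
If \<open>x\<close> had two possible parents, moving it from one to the other would change the sizes of their
branches, but all branches have the same size whatever the choice of parents.
\<close>

lemma tight_common_neighbour_unique:
  assumes t: "tight d" and v: "v \<in> verts G" and x: "x \<in> uncovered {v}"
    and "x \<rightarrow> a" "a \<rightarrow> v" "x \<rightarrow> b" "b \<rightarrow> v"
  shows "a = b"
proof (rule ccontr)
  assume "a \<noteq> b"
  obtain par where par: "parent_map {v} par" using tight_parent_map[OF t v] .
  have pa: "parent_map {v} (par(x := a))" and pb: "parent_map {v} (par(x := b))"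
    using par assms by (auto simp: parent_map_def)
  have "{y\<in>uncovered {v}. (par(x := a)) y = a} = insert x {y\<in>uncovered {v}. (par(x := b)) y = a}"
    using x \<open>a \<noteq> b\<close> by auto
  moreover have "x \<notin> {y\<in>uncovered {v}. (par(x := b)) y = a}" using \<open>a \<noteq> b\<close> by auto
  ultimately have "card {y\<in>uncovered {v}. (par(x := a)) y = a} = Suc (card {y\<in>uncovered {v}. (par(x := b)) y = a})"
    using finite_uncovered by simp
  then show False
    using tight_balanced(2)[OF t v pa \<open>a \<rightarrow> v\<close>] tight_balanced(2)[OF t v pb \<open>a \<rightarrow> v\<close>] by simp
qed

lemma tight_card_children:
  assumes t: "tight d" and "u \<rightarrow> v"
  shows "1 + card {x\<in>uncovered {v}. x \<rightarrow> u} = unit_acquisition_number G"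
proof -
  have v: "v \<in> verts G" using assms(2) adj_in_verts by blast
  obtain par where par: "parent_map {v} par" using tight_parent_map[OF t v] .
  have "{x\<in>uncovered {v}. x \<rightarrow> u} = {x\<in>uncovered {v}. par x = u}"
    using par tight_common_neighbour_unique[OF t v _ _ \<open>u \<rightarrow> v\<close>] by (auto simp: parent_map_def)
  then show ?thesis using tight_balanced(2)[OF t v par assms(2)] by simp
qed

lemma tight_imp_complete:
  assumes t: "tight d" and "unit_acquisition_number G = 1"
  shows "complete_digraph (card (verts G)) G"
proof -
  have "closed_nbs v = verts G" if v: "v \<in> verts G" for v
  proof (rule card_subset_eq[OF finite_verts])
    show "closed_nbs v \<subseteq> verts G" using v nbs_subset_verts by simp
    have "v \<notin> nbs v" using adj_not_same by auto
    then show "card (closed_nbs v) = card (verts G)"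
      using tight_degree[OF t v] t assms(2) finite_nbs by (simp add: tight_def)
  qed
  then have "u \<rightarrow> v \<longleftrightarrow> u \<in> verts G \<and> v \<in> verts G \<and> u \<noteq> v" for u v
    using adj_in_verts adj_not_same by blast
  then have "arcs_ends G = {(u, v). (u, v) \<in> verts G \<times> verts G \<and> u \<noteq> v}"
    by auto
  then show ?thesis
    using graph_axioms by (simp add: complete_digraph_def)
qed

section \<open>The graphs attaining the bound\<close>

text \<open>
If every branch has at least two leaves, one of the leaves \<open>x\<close> stranded by the sacrifice of \<open>u1\<close> can be
saved, which contradicts minimality. The detour leads over another branch: some \<open>u2\<close> adjacent to the
root but not to \<open>u1\<close> has a child \<open>y\<close> adjacent to \<open>x\<close>, because \<open>x\<close> and \<open>u2\<close> have a common neighbour.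
After \<open>x\<close> has moved to \<open>y\<close>, the vertex \<open>u2\<close> needs weight \<open>2\<close> to receive from \<open>y\<close>, and gets it from a
second child \<open>z\<close>. It then briefly has weight \<open>3\<close>, so the root must have reached \<open>3\<close> before, which it
does by absorbing the branch of a third neighbour \<open>u3\<close>. Both \<open>u2\<close> and \<open>u3\<close> come from the count of
children with the roles of \<open>u1\<close> and \<open>v\<close> exchanged: seen from \<open>u1\<close>, the vertex \<open>v\<close> has at least two
children.
\<close>

lemma tight_unit_acquisition_le_2:
  assumes t: "tight d" and v: "v \<in> verts G"
  shows "unit_acquisition_number G \<le> 2"
proof (rule ccontr)
  let ?k = "unit_acquisition_number G"
  assume "\<not> ?k \<le> 2"
  then have k: "3 \<le> ?k" by simp
  have "nbs v \<noteq> {}" by (rule tight_nbs_nonempty[OF t v])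
  then obtain u1 where u1: "u1 \<rightarrow> v" by blast
  have "2 \<le> card {x\<in>uncovered {u1}. x \<rightarrow> v}"
    using tight_card_children[OF t adj_sym[OF u1]] k by simp
  then obtain u2 u3 where u23: "u2 \<in> uncovered {u1}" "u2 \<rightarrow> v" "u3 \<in> uncovered {u1}" "u3 \<rightarrow> v" "u2 \<noteq> u3"
    by (auto simp: numeral_2_eq_2 card_le_Suc_iff)
  then have u2: "u2 \<noteq> u1" "u3 \<noteq> u1" "\<not> u2 \<rightarrow> u1" "\<not> u1 \<rightarrow> u2" and "u2 \<in> verts G"
    by (auto simp: uncovered_singleton dest: adj_sym)
  have "2 \<le> card {x\<in>uncovered {v}. x \<rightarrow> u1}"
    using tight_card_children[OF t u1] k by simp
  then have "{x\<in>uncovered {v}. x \<rightarrow> u1} \<noteq> {}" by force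
  then obtain x where x: "x \<in> uncovered {v}" "x \<rightarrow> u1" by blast
  note uniq = tight_common_neighbour_unique[OF t v]
  have "\<not> x \<rightarrow> u2" using uniq[OF x(1) x(2) u1 _ u23(2)] u2 by blast
  moreover have "x \<noteq> u2" using x(1) u23(2) by (auto simp: uncovered_singleton)
  ultimately have "x \<in> uncovered {u2}" using x(1) by (simp add: uncovered_singleton)
  then obtain y where y: "x \<rightarrow> y" "y \<rightarrow> u2"
    using tight_parent_exists[OF t \<open>u2 \<in> verts G\<close>] by blast
  have "y \<noteq> v" using x(1) y(1) by (auto simp: uncovered_singleton)
  moreover have "\<not> y \<rightarrow> v" using uniq[OF x(1) x(2) u1 y(1)] u2(4) y(2) by blast
  ultimately have y': "y \<in> uncovered {v}" using y(2) adj_in_verts by (simp add: uncovered_singleton)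
  have "2 \<le> card {z\<in>uncovered {v}. z \<rightarrow> u2}"
    using tight_card_children[OF t u23(2)] k by simp
  then have "{z\<in>uncovered {v}. z \<rightarrow> u2} - {y} \<noteq> {}"
    using card_mono[of "{y}" "{z\<in>uncovered {v}. z \<rightarrow> u2}"] by auto
  then obtain z where z: "z \<in> uncovered {v}" "z \<rightarrow> u2" "z \<noteq> y" by blast
  obtain par where par: "parent_map {v} par" using tight_parent_map[OF t v] .
  have par_eq: "par a = u" if "a \<in> uncovered {v}" "a \<rightarrow> u" "u \<rightarrow> v" for a u
    using par that uniq by (auto simp: parent_map_def)
  have pxyz: "par x = u1" "par y = u2" "par z = u2"
    using par_eq x y(2) y' z u1 u23(2) by auto
  have notin: "v \<notin> uncovered {v}" "u \<notin> uncovered {v}" if "u \<rightarrow> v" for u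
    using that by (auto simp: uncovered_singleton)
  have ne: "v \<noteq> u1" "v \<noteq> u2" "x \<noteq> v" "x \<noteq> u1" "x \<noteq> u2" "y \<noteq> v" "y \<noteq> u1" "y \<noteq> u2"
    "z \<noteq> v" "z \<noteq> u1" "z \<noteq> u2" "x \<noteq> y" "x \<noteq> z"
    using notin u1 u23(2) x(1) y' z(1) pxyz u2(1) adj_not_same by metis+
  let ?B = "nbs v - {u1, u2}"
  let ?L = "{a\<in>uncovered {v}. par a \<in> ?B}"
  (* Sacrifice u1, absorb the branches other than u1 and u2, make the detour of x
     (w2 to w7), absorb what remains of the branch of u2. *)
  define w1 where "w1 = (\<lambda>_. 1 :: nat)(u1 := 0, v := 2)"
  have m1: "moves (\<lambda>_. 1) w1"
    using moveI[OF u1, of "\<lambda>_. 1"] by (simp add: w1_def numeral_2_eq_2)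
  have "\<exists>w2. moves w1 w2 \<and> w1 v + card ?B \<le> w2 v \<and> (\<forall>x\<in>?B \<union> ?L. w2 x = 0)
    \<and> (\<forall>x. x \<notin> insert v (?B \<union> ?L) \<longrightarrow> w2 x = w1 x)"
  proof (rule absorb_branches)
    show "\<forall>x\<in>?B \<union> ?L. w1 x = 1"
      using notin[OF u1] adj_not_same by (auto simp: w1_def)
    show "?B \<inter> uncovered {v} = {}" using notin by blast
  qed (use par notin[OF u1] finite_nbs in \<open>auto simp: w1_def parent_map_def finite_uncovered\<close>)
  then obtain w2 where m2: "moves w1 w2" and w2v: "w1 v + card ?B \<le> w2 v"
    and w2: "\<forall>x\<in>?B \<union> ?L. w2 x = 0" "\<forall>x. x \<notin> insert v (?B \<union> ?L) \<longrightarrow> w2 x = w1 x"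
    by blast
  have "u3 \<in> ?B" using u23 u2 by simp
  then have "0 < card ?B" using finite_nbs by (auto simp: card_gt_0_iff)
  then have v3: "3 \<le> w2 v" using w2v by (simp add: w1_def)
  have w2_1: "w2 a = 1" if "a \<in> insert u2 {a\<in>uncovered {v}. par a \<in> {u1, u2}}" for a
  proof -
    have "a \<notin> insert v (?B \<union> ?L)" "a \<noteq> u1"
      using that ne u1 u23(2) u2(1) by (auto simp: uncovered_singleton)
    then show ?thesis using w2(2) by (auto simp: w1_def)
  qed
  have w2xyz: "w2 x = 1" "w2 y = 1" "w2 z = 1" "w2 u2 = 1"
    using w2_1 x y' z pxyz by auto
  define w3 where "w3 = w2(x := 0, y := 2)"
  have m3: "moves w2 w3"
    using moveI[OF y(1), of w2] w2xyz by (simp add: w3_def numeral_2_eq_2)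
  define w4 where "w4 = w3(z := 0, u2 := 2)"
  have m4: "moves w3 w4"
    using moveI[OF z(2), of w3] w2xyz ne z(3) by (simp add: w3_def w4_def numeral_2_eq_2)
  define w5 where "w5 = w4(y := 1, u2 := 3)"
  have m5: "moves w4 w5"
    using moveI[OF y(2), of w4] ne z(3) by (simp add: w3_def w4_def w5_def eval_nat_numeral)
  define w6 where "w6 = w5(u2 := 2, v := w2 v + 1)"
  have m6: "moves w5 w6"
    using moveI[OF u23(2), of w5] ne v3 by (simp add: w3_def w4_def w5_def w6_def eval_nat_numeral)
  define w7 where "w7 = w6(u2 := 1, v := w2 v + 2)"
  have m7: "moves w6 w7"
    using moveI[OF u23(2), of w6] ne v3 by (simp add: w6_def w7_def eval_nat_numeral)
  let ?C2 = "{a\<in>uncovered {v}. par a = u2} - {z}"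
  have "\<exists>w8. moves w7 w8 \<and> w8 v = w7 v + 1 + card ?C2 \<and> (\<forall>x\<in>insert u2 ?C2. w8 x = 0)
    \<and> (\<forall>x. x \<notin> insert v (insert u2 ?C2) \<longrightarrow> w8 x = w7 x)"
  proof (rule absorb_branch)
    show "\<forall>c\<in>?C2. c \<rightarrow> u2" using par by (auto simp: parent_map_def)
    show "\<forall>c\<in>?C2. w7 c = 1"
    proof
      fix c assume c: "c \<in> ?C2"
      then have "c \<noteq> x" "c \<noteq> z" "c \<noteq> u2" "c \<noteq> v" "w2 c = 1"
        using pxyz u2(1) notin u23(2) w2_1 by auto
      then show "w7 c = 1" by (auto simp: w3_def w4_def w5_def w6_def w7_def)
    qed
  qed (use finite_uncovered u23(2) ne notin[OF u1] v3 in \<open>auto simp: w7_def\<close>)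
  then obtain w8 where m8: "moves w7 w8" and w8: "\<forall>x\<in>insert u2 ?C2. w8 x = 0"
    "\<forall>x. x \<notin> insert v (insert u2 ?C2) \<longrightarrow> w8 x = w7 x" by blast
  have "moves (\<lambda>_. 1) w8"
    using m1 m2 m3 m4 m5 m6 m7 m8 by (meson rtranclp_trans)
  then have "?k \<le> card {a \<in> verts G. 0 < w8 a}" by (rule unit_acquisition_number_le)
  also have "\<dots> \<le> card (insert v ({a\<in>uncovered {v}. par a = u1} - {x}))"
  proof (rule card_mono)
    show "{a \<in> verts G. 0 < w8 a} \<subseteq> insert v ({a\<in>uncovered {v}. par a = u1} - {x})"
    proof (rule subsetI, rule ccontr)
      fix a assume a: "a \<in> {a \<in> verts G. 0 < w8 a}"
        and out: "a \<notin> insert v ({a\<in>uncovered {v}. par a = u1} - {x})"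
      then have "w8 a \<noteq> 0" by simp
      have a8: "a \<noteq> v" "a \<notin> insert u2 ?C2"
        using out w8(1) \<open>w8 a \<noteq> 0\<close> by (blast, metis)
      then have "w8 a = w7 a" using w8(2) by simp
      moreover have "a \<noteq> y" using a8 y' pxyz z(3) by auto
      ultimately have "w2 a \<noteq> 0" "a \<noteq> x" "a \<noteq> z"
        using a a8 ne by (auto simp: w3_def w4_def w5_def w6_def w7_def split: if_splits)
      have aB: "a \<notin> ?B \<union> ?L" using bspec[OF w2(1), of a] \<open>w2 a \<noteq> 0\<close> by linarith
      then have "a \<noteq> u1" using w2(2) a8 \<open>w2 a \<noteq> 0\<close> by (auto simp: w1_def)
      then have "a \<in> uncovered {v}" using aB a8 a by (auto simp: uncovered_singleton)
      moreover from this have "par a \<in> nbs v" using par by (auto simp: parent_map_def)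
      ultimately show False using aB a8 out \<open>a \<noteq> x\<close> \<open>a \<noteq> z\<close> by auto
    qed
  qed (simp add: finite_uncovered)
  also have "\<dots> = Suc (card ({a\<in>uncovered {v}. par a = u1} - {x}))"
    using notin[OF u1] finite_uncovered by simp
  also have "\<dots> = card {a\<in>uncovered {v}. par a = u1}"
    using x pxyz finite_uncovered by (intro card_Suc_Diff1) auto
  finally show False using tight_balanced(2)[OF t v par u1] by simp
qed

text \<open>
Every neighbour \<open>u\<close> of the centre \<open>v\<close> has exactly one child when seen from \<open>v\<close>. Exchanging the roles,
\<open>v\<close> has exactly one child when seen from \<open>u\<close>; that is, \<open>u\<close> misses exactly one other neighbour of \<open>v\<close>.
A third neighbour would therefore be adjacent to both members of a nonadjacent pair \<open>u1\<close>, \<open>u2\<close> in the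
neighbourhood of \<open>v\<close>, and be a second common neighbour of that pair.
\<close>

lemma tight_degree_2:
  assumes t: "tight d" and v: "v \<in> verts G" and k: "unit_acquisition_number G = 2"
  shows "d = 2"
proof -
  have "nbs v \<noteq> {}" by (rule tight_nbs_nonempty[OF t v])
  then obtain u1 where u1: "u1 \<rightarrow> v" by blast
  have children: "card {x\<in>uncovered {b}. x \<rightarrow> a} = 1" if "a \<rightarrow> b" for a b
    using tight_card_children[OF t that] k by simp
  obtain u2 where u2: "{x\<in>uncovered {u1}. x \<rightarrow> v} = {u2}"
    using children[OF adj_sym[OF u1]] by (rule card_1_singletonE)
  then have u2': "u2 \<in> uncovered {u1}" "u2 \<rightarrow> v" by auto
  then have u12: "u1 \<noteq> u2" "\<not> u1 \<rightarrow> u2" "u1 \<in> uncovered {u2}"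
    using u1 adj_in_verts by (auto simp: uncovered_singleton dest: adj_sym)
  have "nbs v = {u1, u2}"
  proof (rule ccontr)
    assume "nbs v \<noteq> {u1, u2}"
    then obtain u3 where u3: "u3 \<rightarrow> v" "u3 \<noteq> u1" "u3 \<noteq> u2" using u1 u2' by blast
    then have "u3 \<rightarrow> u1" using u2 adj_in_verts by (auto simp: uncovered_singleton)
    obtain u4 where u4: "{x\<in>uncovered {u2}. x \<rightarrow> v} = {u4}"
      using children[OF adj_sym[OF u2'(2)]] by (rule card_1_singletonE)
    have "u1 \<in> {x\<in>uncovered {u2}. x \<rightarrow> v}" using u12(3) u1 by simp
    then have "{x\<in>uncovered {u2}. x \<rightarrow> v} = {u1}" using u4 by simp
    then have "u3 \<rightarrow> u2" using u3 adj_in_verts by (auto simp: uncovered_singleton)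
    have "u2 \<in> verts G" using u2'(2) adj_in_verts by blast
    then have "u3 = v"
      using tight_common_neighbour_unique[OF t _ u12(3), of u3 v] \<open>u3 \<rightarrow> u1\<close> \<open>u3 \<rightarrow> u2\<close> u1 u2'(2)
      by (blast dest: adj_sym)
    then show False using u3(1) adj_not_same by blast
  qed
  then show ?thesis using tight_degree[OF t v] u12(1) by simp
qed

definition five_cycle :: "'a \<Rightarrow> 'a \<Rightarrow> 'a \<Rightarrow> 'a \<Rightarrow> 'a \<Rightarrow> bool" where
  "five_cycle a b c d e \<longleftrightarrow> distinct [a, b, c, d, e] \<and> verts G = {a, b, c, d, e}
    \<and> nbs a = {e, b} \<and> nbs b = {a, c} \<and> nbs c = {b, d} \<and> nbs d = {c, e} \<and> nbs e = {d, a}"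

lemma tight_imp_five_cycle:
  assumes t: "tight d" and v: "v \<in> verts G" and k: "unit_acquisition_number G = 2"
  shows "\<exists>a b c d e. five_cycle a b c d e"
proof -
  have d: "d = 2" by (rule tight_degree_2[OF assms])
  have deg: "card (nbs x) = 2" if "x \<in> verts G" for x
    using tight_degree[OF t that] d by simp
  obtain a b where ab: "nbs v = {a, b}" "a \<noteq> b" using deg[OF v] by (auto simp: card_2_iff)
  then have av: "a \<rightarrow> v" and bv: "b \<rightarrow> v" by auto
  have children: "card {x\<in>uncovered {v}. x \<rightarrow> u} = 1" if "u \<rightarrow> v" for u
    using tight_card_children[OF t that] k by simp
  obtain x where "{x\<in>uncovered {v}. x \<rightarrow> a} = {x}"
    using children[OF av] by (rule card_1_singletonE)
  then have x: "x \<in> uncovered {v}" "x \<rightarrow> a" by auto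
  obtain y where "{y\<in>uncovered {v}. y \<rightarrow> b} = {y}"
    using children[OF bv] by (rule card_1_singletonE)
  then have y: "y \<in> uncovered {v}" "y \<rightarrow> b" by auto
  note uniq = tight_common_neighbour_unique[OF t v]
  have xb: "\<not> x \<rightarrow> b" using uniq[OF x av _ bv] ab(2) by blast
  have ya: "\<not> y \<rightarrow> a" using uniq[OF y bv _ av] ab(2) by blast
  have xy: "x \<noteq> v" "y \<noteq> v" "x \<notin> nbs v" "y \<notin> nbs v" "x \<noteq> y"
    using x y ya by (auto simp: uncovered_singleton)
  have dist: "distinct [v, a, x, y, b]"
    using xy ab av bv adj_not_same by auto
  have in_verts: "a \<in> verts G" "b \<in> verts G" "x \<in> verts G" "y \<in> verts G"
    using av bv x y adj_in_verts by blast+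
  have nbs_eqI: "nbs p = {q, r}" if "p \<in> verts G" "q \<rightarrow> p" "r \<rightarrow> p" "q \<noteq> r" for p q r
  proof -
    have "{q, r} \<subseteq> nbs p" "card {q, r} = card (nbs p)" using that deg by auto
    then show ?thesis using card_subset_eq[OF finite_nbs] by metis
  qed
  have "verts G = {v, a, x, y, b}"
  proof (rule card_subset_eq[OF finite_verts, symmetric])
    show "{v, a, x, y, b} \<subseteq> verts G" using v in_verts by auto
    show "card {v, a, x, y, b} = card (verts G)"
      using dist t k d by (simp add: tight_def)
  qed
  moreover have na: "nbs a = {v, x}" using nbs_eqI[OF in_verts(1)] av x xy adj_sym by blast
  moreover have nb: "nbs b = {y, v}" using nbs_eqI[OF in_verts(2)] bv y xy adj_sym by blast
  moreover have "x \<rightarrow> y"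
  proof -
    have "nbs x \<noteq> {a}" using deg[OF in_verts(3)] by force
    moreover have "a \<rightarrow> x" using x adj_sym by blast
    ultimately obtain q where q: "q \<rightarrow> x" "q \<noteq> a" by blast
    then have "q \<in> {v, a, x, y, b}" using \<open>verts G = _\<close> adj_in_verts by blast
    moreover have "q \<noteq> v" "q \<noteq> x" "q \<noteq> b" using q xb xy adj_sym adj_not_same by blast+
    ultimately show ?thesis using q adj_sym by auto
  qed
  moreover have "nbs x = {a, y}" using nbs_eqI[OF in_verts(3)] x \<open>x \<rightarrow> y\<close> ya adj_sym dist by auto
  moreover have "nbs y = {x, b}" using nbs_eqI[OF in_verts(4)] y \<open>x \<rightarrow> y\<close> xb adj_sym dist by auto
  ultimately have "five_cycle v a x y b"
    using dist ab(1) by (auto simp: five_cycle_def insert_commute)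
  then show ?thesis by blast
qed

section \<open>The acquisition number of the five-cycle\<close>

lemma five_cycle_rotate:
  assumes "five_cycle a b c d e"
  shows "five_cycle b c d e a"
  using assms unfolding five_cycle_def
  by (elim conjE, intro conjI) (simp_all add: insert_commute eq_commute[of a])

lemma five_cycle_reflect:
  assumes "five_cycle a b c d e"
  shows "five_cycle e d c b a"
  using assms unfolding five_cycle_def
  by (elim conjE, intro conjI) (simp_all add: insert_commute, metis)

lemma five_cycle_distinct: "five_cycle a b c d e \<Longrightarrow> distinct [a, b, c, d, e]"
  unfolding five_cycle_def by (elim conjE)

lemma five_cycle_verts: "five_cycle a b c d e \<Longrightarrow> verts G = {a, b, c, d, e}"
  unfolding five_cycle_def by (elim conjE)

lemma five_cycle_nbs:
  assumes "five_cycle a b c d e"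
  shows "nbs a = {e, b}" "nbs b = {a, c}" "nbs c = {b, d}" "nbs d = {c, e}" "nbs e = {d, a}"
  using assms by (simp_all only: five_cycle_def)

lemma five_cycle_adj_cases:
  assumes cyc: "five_cycle a b c d e" and "u \<rightarrow> v"
  shows "(u, v) \<in> {(a, b), (b, a), (b, c), (c, b), (c, d), (d, c), (d, e), (e, d), (e, a), (a, e)}"
    (is "_ \<in> ?R")
proof -
  have into: "nbs a \<times> {a} \<subseteq> ?R" "nbs b \<times> {b} \<subseteq> ?R" "nbs c \<times> {c} \<subseteq> ?R"
    "nbs d \<times> {d} \<subseteq> ?R" "nbs e \<times> {e} \<subseteq> ?R"
    unfolding five_cycle_nbs[OF cyc] by simp_all
  have "v \<in> verts G" using assms(2) by (rule adj_in_verts(2))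
  then have "v \<in> {a, b, c, d, e}" by (simp only: five_cycle_verts[OF cyc])
  moreover have "(u, v) \<in> nbs v \<times> {v}" using assms(2) by simp
  ultimately show ?thesis using into by (elim insertE emptyE; hypsubst) (erule (1) subsetD)+
qed

lemma five_cycle_starting_at:
  assumes "five_cycle a b c d e" and "u \<rightarrow> v"
  shows "\<exists>b c d. five_cycle v b c d u"
proof -
  note r1 = five_cycle_rotate[OF assms(1)]
  note r2 = five_cycle_rotate[OF r1]
  note r3 = five_cycle_rotate[OF r2]
  note r4 = five_cycle_rotate[OF r3]
  note rotations = assms(1) r1 r2 r3 r4
  show ?thesis
    using five_cycle_adj_cases[OF assms] rotations rotations[THEN five_cycle_reflect] by fast
qed

lemma five_cycle_degree:
  assumes "five_cycle a b c d e" and "v \<in> verts G"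
  shows "card (nbs v) = 2"
proof -
  have "v \<in> {a, b, c, d, e}" using assms(2) by (simp only: five_cycle_verts[OF assms(1)])
  then show ?thesis
    using five_cycle_distinct[OF assms(1)]
    by (elim insertE emptyE; simp only: five_cycle_nbs[OF assms(1)]) (auto simp: card_2_iff)
qed

text \<open>
These are, up to the symmetries of the cycle, the initial configuration and the two configurations that
can follow it while the support is connected; \<open>split\<close> covers all configurations in which two zeros
separate positive weight at \<open>b\<close> from positive weight on \<open>{d, e}\<close>. A vertex of weight zero never receives
weight again, so the total weight on each side never changes and the separation is permanent.
\<close>

inductive divided :: "('a \<Rightarrow> nat) \<Rightarrow> bool" where
  start: "five_cycle a b c d e \<Longrightarrow>
    w a = 1 \<Longrightarrow> w b = 1 \<Longrightarrow> w c = 1 \<Longrightarrow> w d = 1 \<Longrightarrow> w e = 1 \<Longrightarrow> divided w"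
| path4: "five_cycle a b c d e \<Longrightarrow>
    w a = 2 \<Longrightarrow> w b = 1 \<Longrightarrow> w c = 1 \<Longrightarrow> w d = 1 \<Longrightarrow> w e = 0 \<Longrightarrow> divided w"
| path3: "five_cycle a b c d e \<Longrightarrow>
    w a = 2 \<Longrightarrow> w b = 1 \<Longrightarrow> w c = 2 \<Longrightarrow> w d = 0 \<Longrightarrow> w e = 0 \<Longrightarrow> divided w"
| split: "five_cycle a b c d e \<Longrightarrow>
    w a = 0 \<Longrightarrow> 0 < w b \<Longrightarrow> w c = 0 \<Longrightarrow> 0 < w d + w e \<Longrightarrow> divided w"

lemma divided_move:
  assumes "divided w" and "unit_acquisition_move G w w'"
  shows "divided w'"
proof -
  obtain u v where uv: "u \<rightarrow> v" "0 < w u" "w u \<le> w v" and w': "w' = w(u := w u - 1, v := w v + 1)"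
    using assms(2) unfolding unit_acquisition_move_def by (elim exE conjE) (rule that)
  from assms(1) show ?thesis
  proof cases
    case (start a b c d e)
    note cyc = start(1)
    obtain b' c' d' where cyc': "five_cycle v b' c' d' u"
      using five_cycle_starting_at[OF cyc uv(1)] by blast
    have "w x = 1" if "x \<in> verts G" for x
      using that start five_cycle_verts[OF cyc] by auto
    then show ?thesis
      using five_cycle_verts[OF cyc'] five_cycle_distinct[OF cyc']
      by (intro divided.path4[OF cyc']) (auto simp: w')
  next
    case (path4 a b c d e)
    note cyc = path4(1)
    note r1 = five_cycle_rotate[OF cyc]
    note r2 = five_cycle_rotate[OF r1]
    note r3 = five_cycle_rotate[OF r2]
    note r4 = five_cycle_rotate[OF r3]
    have dist: "distinct [a, b, c, d, e]" by (rule five_cycle_distinct[OF cyc])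
    consider "u = b" "v = a" | "u = c" "v = b" | "u = d" "v = c" | "u = b" "v = c" | "u = c" "v = d"
      using five_cycle_adj_cases[OF cyc uv(1)] uv(2,3) path4 by auto
    then show ?thesis
    proof cases
      case 1
      with path4 dist show ?thesis
        by (intro divided.split[OF r4]) (auto simp: w')
    next
      case 2
      with path4 dist show ?thesis
        by (intro divided.split[OF r2]) (auto simp: w')
    next
      case 3
      with path4 dist show ?thesis
        by (intro divided.path3[OF cyc]) (auto simp: w')
    next
      case 4
      with path4 dist show ?thesis
        by (intro divided.split[OF r4]) (auto simp: w')
    next
      case 5
      with path4 dist show ?thesis
        by (intro divided.split[OF r2]) (auto simp: w')
    qed
  next
    case (path3 a b c d e)
    note cyc = path3(1)
    note r1 = five_cycle_rotate[OF cyc]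
    have dist: "distinct [a, b, c, d, e]" by (rule five_cycle_distinct[OF cyc])
    have "u = b \<and> (v = a \<or> v = c)"
      using five_cycle_adj_cases[OF cyc uv(1)] uv(2,3) path3 by auto
    with path3 dist show ?thesis
      by (intro divided.split[OF r1]) (auto simp: w')
  next
    case (split a b c d e)
    note cyc = split(1)
    have dist: "distinct [a, b, c, d, e]" by (rule five_cycle_distinct[OF cyc])
    have "u = d \<and> v = e \<or> u = e \<and> v = d"
      using five_cycle_adj_cases[OF cyc uv(1)] uv(2,3) split by auto
    with split dist show ?thesis
      by (intro divided.split[OF cyc]) (auto simp: w')
  qed
qed

lemma five_cycle_unit_acquisition_ge_2:
  assumes cyc: "five_cycle a b c d e"
  shows "2 \<le> unit_acquisition_number G"
proof -
  have div: "divided w" if "moves (\<lambda>_. 1) w" for w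
    using that
  proof (induction rule: rtranclp_induct)
    case base
    show ?case by (rule divided.start[OF cyc]) simp_all
  qed (rule divided_move)
  have two: "2 \<le> card {v \<in> verts G. 0 < w v}" if w: "moves (\<lambda>_. 1) w" for w
  proof -
    have "\<exists>x y. {x, y} \<subseteq> {v \<in> verts G. 0 < w v} \<and> x \<noteq> y"
      using div[OF w]
    proof cases
      case (start a b c d e)
      then have "{a, b} \<subseteq> {v \<in> verts G. 0 < w v}" "a \<noteq> b"
        using five_cycle_verts[OF start(1)] five_cycle_distinct[OF start(1)] by simp_all
      then show ?thesis by blast
    next
      case (path4 a b c d e)
      then have "{a, b} \<subseteq> {v \<in> verts G. 0 < w v}" "a \<noteq> b"
        using five_cycle_verts[OF path4(1)] five_cycle_distinct[OF path4(1)] by simp_all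
      then show ?thesis by blast
    next
      case (path3 a b c d e)
      then have "{a, b} \<subseteq> {v \<in> verts G. 0 < w v}" "a \<noteq> b"
        using five_cycle_verts[OF path3(1)] five_cycle_distinct[OF path3(1)] by simp_all
      then show ?thesis by blast
    next
      case (split a b c d e)
      define z where "z = (if 0 < w d then d else e)"
      have "{b, z} \<subseteq> {v \<in> verts G. 0 < w v}" "b \<noteq> z"
        using split(3,5) five_cycle_verts[OF split(1)] five_cycle_distinct[OF split(1)]
        by (auto simp: z_def)
      then show ?thesis by blast
    qed
    then obtain x y where xy: "{x, y} \<subseteq> {v \<in> verts G. 0 < w v}" "x \<noteq> y"
      by (elim exE conjE) (rule that)
    have "card {x, y} \<le> card {v \<in> verts G. 0 < w v}"
      using xy(1) by (intro card_mono) simp_all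
    then show ?thesis using xy(2) by simp
  qed
  show ?thesis using unit_acquisition_number_attained two by metis
qed

section \<open>Isomorphism with the five-cycle\<close>

lemma pverts_cycle_graph_5: "pverts (cycle_graph 5) = {0, 1, 2, 3, 4}"
  by (auto simp: cycle_graph_def)

lemma parcs_cycle_graph_5: "parcs (cycle_graph 5) =
  {(0, 1), (1, 0), (1, 2), (2, 1), (2, 3), (3, 2), (3, 4), (4, 3), (4, 0), (0, 4)}"
proof -
  have range: "[0..<5] = [0, 1, 2, 3, 4::nat]" by (simp add: upt_rec)
  have "parcs (cycle_graph 5)
      = set (filter (\<lambda>(i, j). j = Suc i mod 5 \<or> i = Suc j mod 5) (List.product [0..<5] [0..<5]))"
    by (auto simp: cycle_graph_def)
  also have "\<dots> = {(0, 1), (1, 0), (1, 2), (2, 1), (2, 3), (3, 2), (3, 4), (4, 3), (4, 0), (0, 4)}"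
    unfolding range by (simp add: insert_commute)
  finally show ?thesis .
qed

lemma five_cycle_arcs_ends:
  assumes "five_cycle a b c d e"
  shows "arcs_ends G = {(a, b), (b, a), (b, c), (c, b), (c, d), (d, c), (d, e), (e, d), (e, a), (a, e)}"
  (is "_ = ?R")
proof (intro equalityI subrelI)
  fix u v assume "(u, v) \<in> ?R"
  moreover note five_cycle_nbs[OF assms]
  ultimately have "u \<in> nbs v"
    by (simp only: insert_iff empty_iff prod.inject) (elim disjE conjE; simp only: insert_iff simp_thms)
  then show "u \<rightarrow> v" by simp
qed (rule five_cycle_adj_cases[OF assms])

lemma five_cycle_imp_iso:
  assumes cyc: "five_cycle a b c d e"
  shows "digraph_iso G (with_proj (cycle_graph 5))"
proof -
  have dist: "distinct [a, b, c, d, e]" and V: "verts G = {a, b, c, d, e}"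
    using five_cycle_distinct[OF cyc] five_cycle_verts[OF cyc] .
  define g :: "'a \<Rightarrow> nat" where
    "g x = (if x = a then 0 else if x = b then 1 else if x = c then 2 else if x = d then 3 else 4)" for x
  have g: "g a = 0" "g b = 1" "g c = 2" "g d = 3" "g e = 4"
    using dist by (auto simp: g_def)
  have inj: "inj_on g (verts G)" unfolding V using g by (auto simp: inj_on_def)
  define h where "h = \<lparr>iso_verts = g, iso_arcs = \<lambda>x. (g (tail G x), g (head G x)),
    iso_head = snd, iso_tail = (fst :: nat \<times> nat \<Rightarrow> nat)\<rparr>"
  have "inj_on (iso_arcs h) (arcs G)"
  proof (rule inj_onI)
    fix x y assume "x \<in> arcs G" "y \<in> arcs G" "iso_arcs h x = iso_arcs h y"
    then show "x = y"
      using inj by (intro no_multi_arcs) (auto simp: h_def arc_to_ends_def inj_on_eq_iff)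
  qed
  then have "digraph_isomorphism h"
    using inj wf_digraph by (simp add: digraph_isomorphism_def h_def)
  moreover have "with_proj (cycle_graph 5) = app_iso h G"
  proof -
    have "arcs (app_iso h G) = (\<lambda>(x, y). (g x, g y)) ` arcs_ends G"
      by (auto simp: h_def arcs_ends_conv image_image)
    also have "\<dots> = parcs (cycle_graph 5)"
      using g by (simp add: five_cycle_arcs_ends[OF cyc] parcs_cycle_graph_5)
    finally show ?thesis
      using g by (intro pre_digraph.equality) (auto simp: h_def V pverts_cycle_graph_5)
  qed
  ultimately show ?thesis unfolding digraph_iso_def by blast
qed

lemma iso_imp_five_cycle:
  assumes "digraph_iso G (with_proj (cycle_graph 5))"
  shows "\<exists>a b c d e. five_cycle a b c d e"
proof -
  obtain h where h: "digraph_isomorphism h" and H: "with_proj (cycle_graph 5) = app_iso h G"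
    using assms unfolding digraph_iso_def by (elim exE conjE) (rule that)
  let ?g = "iso_verts h"
  have inj: "inj_on ?g (verts G)" using h by (simp add: digraph_isomorphism_def)
  have V: "?g ` verts G = {0, 1, 2, 3, 4}"
    using arg_cong[OF H, of verts] by (simp add: pverts_cycle_graph_5)
  have A: "iso_arcs h ` arcs G = parcs (cycle_graph 5)"
    and ends: "iso_tail h = fst" "iso_head h = snd"
    using arg_cong[OF H, of arcs] arg_cong[OF H, of tail] arg_cong[OF H, of head] by simp_all
  have arc: "iso_arcs h x = (?g (tail G x), ?g (head G x))" if "x \<in> arcs G" for x
    using h that by (simp add: digraph_isomorphism_def ends prod_eq_iff)
  have adj: "u \<rightarrow> v \<longleftrightarrow> (?g u, ?g v) \<in> parcs (cycle_graph 5)" if "u \<in> verts G" "v \<in> verts G" for u v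
  proof
    assume "u \<rightarrow> v"
    then show "(?g u, ?g v) \<in> parcs (cycle_graph 5)"
      using arc A by (auto simp: arcs_ends_conv)
  next
    assume "(?g u, ?g v) \<in> parcs (cycle_graph 5)"
    then have "(?g u, ?g v) \<in> iso_arcs h ` arcs G" unfolding A .
    then obtain x where x: "x \<in> arcs G" "iso_arcs h x = (?g u, ?g v)" by (metis imageE)
    then have "tail G x = u" "head G x = v"
      using arc[OF x(1)] inj that by (auto simp: inj_on_eq_iff)
    then show "u \<rightarrow> v" using x(1) by (auto simp: arcs_ends_conv)
  qed
  have pre: "\<exists>x. x \<in> verts G \<and> ?g x = i" if "i \<in> {0, 1, 2, 3, 4}" for i
  proof -
    have "i \<in> ?g ` verts G" using that by (simp only: V)
    then show ?thesis by blast
  qed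
  obtain a where a: "a \<in> verts G" "?g a = 0" using pre[of 0] by auto
  obtain b where b: "b \<in> verts G" "?g b = 1" using pre[of 1] by auto
  obtain c where c: "c \<in> verts G" "?g c = 2" using pre[of 2] by auto
  obtain d where d: "d \<in> verts G" "?g d = 3" using pre[of 3] by auto
  obtain e where e: "e \<in> verts G" "?g e = 4" using pre[of 4] by auto
  note g = a(1) b(1) c(1) d(1) e(1) a(2) b(2) c(2) d(2) e(2)
  have VG: "verts G = {a, b, c, d, e}"
  proof
    show "verts G \<subseteq> {a, b, c, d, e}"
    proof
      fix x assume x: "x \<in> verts G"
      then have "?g x \<in> ?g ` verts G" by blast
      then have "?g x \<in> {?g a, ?g b, ?g c, ?g d, ?g e}" by (simp only: V g)
      then show "x \<in> {a, b, c, d, e}" by (simp add: inj_on_eq_iff[OF inj x] g(1-5))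
    qed
  qed (use g in auto)
  have nbs: "nbs v = {u \<in> {a, b, c, d, e}. (?g u, ?g v) \<in> parcs (cycle_graph 5)}" if "v \<in> verts G" for v
    using adj[OF _ that] VG adj_in_verts by blast
  have "nbs a = {e, b}" unfolding nbs[OF g(1)] parcs_cycle_graph_5 using g by auto
  moreover have "nbs b = {a, c}" unfolding nbs[OF g(2)] parcs_cycle_graph_5 using g by auto
  moreover have "nbs c = {b, d}" unfolding nbs[OF g(3)] parcs_cycle_graph_5 using g by auto
  moreover have "nbs d = {c, e}" unfolding nbs[OF g(4)] parcs_cycle_graph_5 using g by auto
  moreover have "nbs e = {d, a}" unfolding nbs[OF g(5)] parcs_cycle_graph_5 using g by auto
  moreover have "distinct [a, b, c, d, e]" using g by auto
  ultimately have "five_cycle a b c d e"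
    unfolding five_cycle_def using VG by (intro conjI)
  then show ?thesis by blast
qed

end

section \<open>The characterization\<close>

theorem proposition2p6:
  fixes G :: "('a, 'b) pre_digraph" and n :: nat
  assumes "graph G"
    and "verts G \<noteq> {}"
    and "card (verts G) = n"
    and "min_degree G \<ge> 1"
  shows "real (unit_acquisition_number G) \<le> (real n - 1) / real (min_degree G)
    \<and> (real (unit_acquisition_number G) = (real n - 1) / real (min_degree G)
        \<longleftrightarrow> complete_digraph n G \<or> digraph_iso G (with_proj (cycle_graph 5)))"
proof -
  interpret graph G by (rule assms(1))
  let ?d = "min_degree G" and ?k = "unit_acquisition_number G"
  obtain v where v: "v \<in> verts G" using assms(2) by blast
  have deg: "\<forall>v\<in>verts G. ?d \<le> card (nbs v)" using min_degree_le by blast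
  have bound: "?d * ?k + 1 \<le> n"
    using packing_bound[OF packing_singleton[OF v] deg assms(4)] assms(3) by simp
  then have le: "real ?d * real ?k \<le> real n - 1"
    by (metis le_diff_eq of_nat_1 of_nat_add of_nat_le_iff of_nat_mult)
  then have le': "real ?k \<le> (real n - 1) / real ?d"
    using assms(4) by (simp add: pos_le_divide_eq mult.commute)
  have eq: "real ?k = (real n - 1) / real ?d \<longleftrightarrow> ?d * ?k + 1 = n"
  proof -
    have "real ?k = (real n - 1) / real ?d \<longleftrightarrow> real ?d * real ?k + 1 = real n"
      using assms(4) by (auto simp: field_simps)
    also have "\<dots> \<longleftrightarrow> ?d * ?k + 1 = n"
      by (metis of_nat_1 of_nat_add of_nat_eq_iff of_nat_mult)
    finally show ?thesis .
  qed
  have "?d * ?k + 1 = n \<longleftrightarrow> complete_digraph n G \<or> digraph_iso G (with_proj (cycle_graph 5))"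
  proof
    assume "?d * ?k + 1 = n"
    then have t: "tight ?d" using deg assms(3,4) by (simp add: tight_def)
    have "1 \<le> ?k" by (rule unit_acquisition_number_pos[OF assms(2)])
    then consider "?k = 1" | "?k = 2" using tight_unit_acquisition_le_2[OF t v] by linarith
    then show "complete_digraph n G \<or> digraph_iso G (with_proj (cycle_graph 5))"
    proof cases
      case 1
      then show ?thesis using tight_imp_complete[OF t] assms(3) by simp
    next
      case 2
      then show ?thesis using tight_imp_five_cycle[OF t v] five_cycle_imp_iso by blast
    qed
  next
    assume "complete_digraph n G \<or> digraph_iso G (with_proj (cycle_graph 5))"
    then show "?d * ?k + 1 = n"
    proof
      assume "complete_digraph n G"
      then have "nbs u = verts G - {u}" if "u \<in> verts G" for u
        using that by (auto simp: complete_digraph_def)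
      then have "\<forall>u\<in>verts G. card (nbs u) = n - 1" using assms(3) by simp
      then have d: "?d = n - 1" by (rule min_degree_regular[OF assms(2)])
      have "?d * 1 \<le> ?d * ?k"
        using unit_acquisition_number_pos[OF assms(2)] by (rule mult_le_mono2)
      then show ?thesis using bound d assms(4) by linarith
    next
      assume "digraph_iso G (with_proj (cycle_graph 5))"
      then obtain a b c d e where cyc: "five_cycle a b c d e" using iso_imp_five_cycle by blast
      note dist = five_cycle_distinct[OF cyc] and V = five_cycle_verts[OF cyc]
      have "?d = 2"
        using five_cycle_degree[OF cyc] by (intro min_degree_regular[OF assms(2)]) blast
      moreover have "n = 5" using V dist assms(3) by simp
      ultimately show ?thesis using bound five_cycle_unit_acquisition_ge_2[OF cyc] by simp
    qed
  qed
  then show ?thesis using le' eq by blast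
qed

end
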